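(* Let $p\ge 7$ be a prime and $k$ an integer with $(p+2)/3\le k\le p-3$. Then \[ k+1\le \mathsf{BO}(k,\mathbb{Z}/p\mathbb{Z})\le k+2. \]
   Context: For a positive integer $k$, a set $\{g_1,\dots,g_k\}$ of $k$ distinct elements of a finite abelian group $G$ (written additively) is called $k$-barycentric if $\sum_{i=1}^k g_i = k\,g_j$ for some $1\le j\le k$. The $k$-th barycentric Olson constant $\mathsf{BO}(k,G)$ is the smallest integer $\ell$ such that every subset $A\subseteq G$ with $|A|\ge \ell$ contains a $k$-barycentric subset (so that always $\mathsf{BO}(k,G)\le |G|+1$). *)

theory Defs
  imports "HOL-Algebra.Elementary_Groups" "HOL-Algebra.FiniteProduct" "HOL-Computational_Algebra.Primes"
begin

text \<open>Groups are HOL-Algebra structures, written multiplicatively: the paper's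
  additive sum of a subset is the finite product, and k g is g [^] k.\<close>

definition barycentric :: "('a, 'b) monoid_scheme \<Rightarrow> nat \<Rightarrow> 'a set \<Rightarrow> bool" where
  "barycentric G k B \<longleftrightarrow> finite B \<and> card B = k \<and>
     (\<exists>g\<in>B. finprod G (\<lambda>x. x) B = g [^]\<^bsub>G\<^esub> k)"

definition BO :: "nat \<Rightarrow> ('a, 'b) monoid_scheme \<Rightarrow> nat" where
  "BO k G = (LEAST l. \<forall>A. A \<subseteq> carrier G \<and> card A \<ge> l \<longrightarrow>
                 (\<exists>B\<subseteq>A. barycentric G k B))"

end

theory Submission
  imports Defs "HOL-Number_Theory.Residues"
begin

text \<open>For the lower bound, some k-element set of nonzero residues has sum 0, so none of its
  elements is its average. For the upper bound, let A have k + 2 elements with sum s. Deleting a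
  and b from A leaves a k-barycentric set as soon as a + b + k c = s for distinct a, b, c in A.
  If there is no such triple, then by Fermat the polynomials
  (a - b)(a - c)(b - c)(a + b + k c - s)^(p - 1) and (a - b)(a - c)(b - c) agree on A x A x A.
  As in the Combinatorial Nullstellensatz, Lagrange interpolation weights on subsets of sizes
  i + 1, j + 1, l + 1 with i + j + l = p + 2 extract the coefficient of a^i b^j c^l of their
  difference, so it vanishes modulo p. For i \<noteq> j this says that p divides
  k^2 i j + (k + 1) l (l - 1), and two pairs (i, j) with the same sum contradict each other.\<close>

section \<open>Interpolation weights modulo a prime\<close>

text \<open>These weights compute a divided difference of order \<open>n\<close>. Splitting off a
  point \<open>c\<close> lowers the order by one: (f(a) - f(c)) / (a - c) has degree one less than f
  and the same leading coefficient, and the differences are invertible modulo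
  \<open>q\<close>.\<close>

lemma dual_weights_exist:
  fixes q :: int
  assumes q: "prime q" and "finite A" "card A = Suc n"
    and "\<And>a b. a \<in> A \<Longrightarrow> b \<in> A \<Longrightarrow> a \<noteq> b \<Longrightarrow> \<not> q dvd a - b"
  shows "\<exists>w. \<forall>m\<le>n. [(\<Sum>a\<in>A. w a * a ^ m) = (if m = n then 1 else 0)] (mod q)"
  using assms(2-4)
proof (induction n arbitrary: A)
  case 0
  then obtain a where "A = {a}" by (auto simp: card_1_singleton_iff)
  then show ?case by (intro exI[of _ "\<lambda>_. 1"]) auto
next
  case (Suc n)
  from Suc.prems(2) obtain c B where A: "A = insert c B" and c: "c \<notin> B" and B: "card B = Suc n"
    by (metis card_Suc_eq)
  have fB: "finite B" using Suc.prems(1) A by simp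
  obtain w where w: "\<And>m. m \<le> n \<Longrightarrow> [(\<Sum>a\<in>B. w a * a ^ m) = (if m = n then 1 else 0)] (mod q)"
    using Suc.IH[OF fB B] Suc.prems(3) A by (metis insertCI)
  have "\<exists>v. [(a - c) * v = 1] (mod q)" if "a \<in> B" for a
  proof -
    have "\<not> q dvd a - c" using Suc.prems(3)[of a c] A c that by auto
    then have "coprime (a - c) q"
      using q by (metis coprime_commute prime_imp_coprime)
    then show ?thesis by (rule cong_solve_coprime_int)
  qed
  then obtain v where v: "\<And>a. a \<in> B \<Longrightarrow> [(a - c) * v a = 1] (mod q)" by metis
  \<comment> \<open>The value at \<open>c\<close> is chosen so that summing
    \<open>w' a * f a\<close> over \<open>A\<close> gives the sum of
    \<open>w a * v a * (f a - f c)\<close> over \<open>B\<close>.\<close>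
  define w' where "w' a = (if a = c then - (\<Sum>a\<in>B. w a * v a) else w a * v a)" for a
  have "[(\<Sum>a\<in>A. w' a * a ^ m) = (if m = Suc n then 1 else 0)] (mod q)" if m: "m \<le> Suc n" for m
  proof -
    have "(\<Sum>a\<in>A. w' a * a ^ m) = - (\<Sum>a\<in>B. w a * v a) * c ^ m + (\<Sum>a\<in>B. w a * v a * a ^ m)"
    proof -
      have "(\<Sum>a\<in>B. w' a * a ^ m) = (\<Sum>a\<in>B. w a * v a * a ^ m)"
        using c by (intro sum.cong) (auto simp: w'_def)
      then show ?thesis using A c fB by (simp add: w'_def)
    qed
    also have "\<dots> = (\<Sum>a\<in>B. w a * v a * (a ^ m - c ^ m))"
      by (simp add: algebra_simps sum_subtractf sum_distrib_left)
    also have "\<dots> = (\<Sum>a\<in>B. ((a - c) * v a) * (w a * (\<Sum>t<m. c ^ (m - Suc t) * a ^ t)))"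
      by (simp add: power_diff_sumr2 mult_ac)
    also have "[\<dots> = (\<Sum>a\<in>B. 1 * (w a * (\<Sum>t<m. c ^ (m - Suc t) * a ^ t)))] (mod q)"
      by (intro cong_sum cong_mult v cong_refl)
    also have "(\<Sum>a\<in>B. 1 * (w a * (\<Sum>t<m. c ^ (m - Suc t) * a ^ t))) =
        (\<Sum>t<m. c ^ (m - Suc t) * (\<Sum>a\<in>B. w a * a ^ t))"
      by (simp add: sum_distrib_left sum.swap[of _ B] mult_ac)
    also have "[\<dots> = (\<Sum>t<m. c ^ (m - Suc t) * (if t = n then 1 else 0))] (mod q)"
      using m by (intro cong_sum cong_mult w cong_refl) auto
    \<comment> \<open>The index \<open>t = n\<close> occurs only for \<open>m = Suc n\<close>, and
      there the exponent of \<open>c\<close> is 0.\<close>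
    also have "(\<Sum>t<m. c ^ (m - Suc t) * (if t = n then 1 else 0)) = (if m = Suc n then 1 else 0)"
      using m by (auto simp: if_distrib cong: if_cong)
    finally show ?thesis .
  qed
  then show ?case by blast
qed

section \<open>Extracting coefficients from powers of a linear form\<close>

definition falling :: "nat \<Rightarrow> nat \<Rightarrow> int" where
  "falling n x = (\<Prod>t<x. int n - int t)"

lemma falling_Suc: "falling n (Suc x) = falling n x * (int n - int x)"
  by (simp add: falling_def)

lemma falling_self: "falling n n = fact n"
proof -
  have "(\<Prod>t<n. int n - int t) = (\<Prod>t<n. int (n - t))"
    by (intro prod.cong) (auto simp: of_nat_diff)
  also have "\<dots> = fact n"
    unfolding fact_prod_rev by (simp add: atLeast0LessThan)
  finally show ?thesis by (simp add: falling_def)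
qed

lemma falling_eq_0: "n < x \<Longrightarrow> falling n x = 0"
  by (auto simp: falling_def)

text \<open>The weights u, v, w are dual to the monomials: summing u against a polynomial of degree at
  most i yields its coefficient of degree i.\<close>

locale weighted_box =
  fixes q :: int and A B C :: "int set" and u v w :: "int \<Rightarrow> int" and i j l :: nat and K s :: int
  assumes u: "\<And>m. m \<le> i \<Longrightarrow> [(\<Sum>a\<in>A. u a * a ^ m) = (if m = i then 1 else 0)] (mod q)"
    and v: "\<And>m. m \<le> j \<Longrightarrow> [(\<Sum>b\<in>B. v b * b ^ m) = (if m = j then 1 else 0)] (mod q)"
    and w: "\<And>m. m \<le> l \<Longrightarrow> [(\<Sum>c\<in>C. w c * c ^ m) = (if m = l then 1 else 0)] (mod q)"
begin

text \<open>The monomial factor is carried along so that peeling off one linear factor stays within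
  the family; induction on \<open>m\<close> then replaces the multinomial theorem.\<close>

definition moment :: "nat \<Rightarrow> nat \<Rightarrow> nat \<Rightarrow> nat \<Rightarrow> int" where
  "moment x y z m = (\<Sum>a\<in>A. \<Sum>b\<in>B. \<Sum>c\<in>C.
     u a * v b * w c * (a ^ x * b ^ y * c ^ z * (a + b + K * c - s) ^ m))"

lemma moment_Suc:
  "moment x y z (Suc m) =
     moment (Suc x) y z m + moment x (Suc y) z m + K * moment x y (Suc z) m - s * moment x y z m"
  unfolding moment_def sum_distrib_left sum.distrib[symmetric] sum_subtractf[symmetric]
  by (intro sum.cong refl) (simp add: algebra_simps)

lemma moment_0:
  "moment x y z 0 = (\<Sum>a\<in>A. u a * a ^ x) * (\<Sum>b\<in>B. v b * b ^ y) * (\<Sum>c\<in>C. w c * c ^ z)"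
  unfolding moment_def
  by (subst sum_product, simp only: sum_distrib_right, simp only: sum_distrib_left mult_ac power_0 mult_1_left mult_1_right)

lemma moment_0_cong_0:
  assumes "x < i \<or> y < j \<or> z < l"
  shows "[moment x y z 0 = 0] (mod q)"
  using assms u[of x] v[of y] w[of z]
  unfolding moment_0 by (auto simp: cong_0_iff)

text \<open>Each monomial in the expansion has an exponent below its target \<open>i\<close>,
  \<open>j\<close> or \<open>l\<close>, so its weighted sum vanishes.\<close>

lemma moment_low_degree:
  "x + y + z + m < i + j + l \<Longrightarrow> [moment x y z m = 0] (mod q)"
proof (induction m arbitrary: x y z)
  case 0
  then show ?case by (intro moment_0_cong_0) auto
next
  case (Suc m)
  then have "q dvd moment (Suc x) y z m" "q dvd moment x (Suc y) z m"
    "q dvd moment x y (Suc z) m" "q dvd moment x y z m"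
    by (auto simp: cong_0_iff)
  then show ?case by (simp add: moment_Suc cong_0_iff)
qed

text \<open>The coefficient of a^i b^j c^l is m! K^(l-z) / ((i-x)! (j-y)! (l-z)!). Multiplying by i!
  j! l! clears the denominators into falling factorials, whose vanishing also covers exponents above
  their targets.\<close>

lemma moment_top_degree:
  "x + y + z + m = i + j + l \<Longrightarrow>
   [moment x y z m * (fact i * fact j * fact l) =
     fact m * K ^ (l - z) * (falling i x * falling j y * falling l z)] (mod q)"
proof (induction m arbitrary: x y z)
  case 0
  show ?case
  proof (cases "x = i \<and> y = j \<and> z = l")
    case True
    then have "[moment x y z 0 = 1 * 1 * 1] (mod q)"
      unfolding moment_0 using u[of i] v[of j] w[of l] by (intro cong_mult) auto
    then have "[moment x y z 0 * (fact i * fact j * fact l) = 1 * (fact i * fact j * fact l)] (mod q)"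
      by (intro cong_mult) auto
    then show ?thesis using True by (simp add: falling_self)
  next
    \<comment> \<open>As the total degrees agree, an exponent below its target kills the left side
      and one above its target kills the right side.\<close>
    case False
    with 0 have lt: "x < i \<or> y < j \<or> z < l" and "x > i \<or> y > j \<or> z > l" by linarith+
    then have "falling i x * falling j y * falling l z = 0" using falling_eq_0 by auto
    with moment_0_cong_0[OF lt] show ?thesis by (simp only: mult_zero_right cong_0_iff dvd_mult2)
  qed
next
  case (Suc m)
  let ?F = "fact i * fact j * fact l :: int"
  let ?f = "falling i x * falling j y * falling l z"
  \<comment> \<open>For \<open>z \<ge> l\<close> the truncated exponents no longer match, but then
    \<open>falling l z * (int l - int z)\<close> is 0.\<close>
  have zK: "K * (K ^ (l - Suc z) * (falling l z * (int l - int z))) = K ^ (l - z) * (falling l z * (int l - int z))"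
  proof (cases "z < l")
    case True
    then have "K ^ (l - z) = K * K ^ (l - Suc z)"
      by (metis Suc_diff_Suc power_Suc)
    then show ?thesis by simp
  next
    case False
    then show ?thesis by (cases "z = l") (auto simp: falling_eq_0)
  qed
  have deg: "int x + int y + int z + (int m + 1) = int i + int j + int l"
    using Suc.prems by linarith
  have "moment x y z (Suc m) * ?F =
      moment (Suc x) y z m * ?F + moment x (Suc y) z m * ?F + K * (moment x y (Suc z) m * ?F)
      - s * ?F * moment x y z m"
    by (simp add: moment_Suc algebra_simps)
  \<comment> \<open>The \<open>s\<close> part is one degree short of \<open>i + j + l\<close> and
    drops out by \<open>moment_low_degree\<close>.\<close>
  also have "[\<dots> =
      fact m * K ^ (l - z) * (falling i (Suc x) * falling j y * falling l z)
      + fact m * K ^ (l - z) * (falling i x * falling j (Suc y) * falling l z)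
      + K * (fact m * K ^ (l - Suc z) * (falling i x * falling j y * falling l (Suc z)))
      - s * ?F * 0] (mod q)"
    using Suc.prems
    by (intro cong_add cong_diff cong_mult[OF cong_refl] Suc.IH moment_low_degree) auto
  also have "fact m * K ^ (l - z) * (falling i (Suc x) * falling j y * falling l z)
      + fact m * K ^ (l - z) * (falling i x * falling j (Suc y) * falling l z)
      + K * (fact m * K ^ (l - Suc z) * (falling i x * falling j y * falling l (Suc z)))
      - s * ?F * 0
     = fact m * K ^ (l - z) * ?f * (int i - int x) + fact m * K ^ (l - z) * ?f * (int j - int y)
       + fact m * (falling i x * falling j y) *
          (K * (K ^ (l - Suc z) * (falling l z * (int l - int z))))"
    by (simp add: falling_Suc mult_ac)
  also have "\<dots> = fact m * K ^ (l - z) * ?f * ((int i - int x) + (int j - int y) + (int l - int z))"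
    unfolding zK by (simp add: algebra_simps)
  also have "(int i - int x) + (int j - int y) + (int l - int z) = int (Suc m)"
    using deg by simp
  also have "fact m * K ^ (l - z) * ?f * int (Suc m) = fact (Suc m) * K ^ (l - z) * ?f"
    by (simp only: fact_Suc of_nat_mult of_nat_id mult_ac)
  finally show ?case .
qed

end


section \<open>Fermat's theorem and the divisibility condition\<close>

lemma fermat_int:
  fixes x :: int
  assumes "prime p" and "\<not> int p dvd x"
  shows "[x ^ (p - 1) = 1] (mod int p)"
proof -
  define y where "y = nat (x mod int p)"
  have p: "p > 0" using assms(1) prime_gt_0_nat by blast
  have y: "int y = x mod int p" using p by (simp add: y_def)
  then have xy: "[x = int y] (mod int p)" by (simp add: cong_def)
  have "\<not> p dvd y"
    using assms(2) cong_dvd_iff[OF xy] unfolding int_dvd_int_iff[symmetric] by (simp add: dvd_eq_mod_eq_0 cong_def y)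
  then have "[y ^ (p - 1) = 1] (mod p)" by (rule fermat_theorem[OF assms(1)])
  then have "[int y ^ (p - 1) = 1] (mod int p)"
    by (metis cong_int_iff of_nat_1 of_nat_power)
  then show ?thesis using cong_pow[OF xy] cong_trans by blast
qed

text \<open>The degree 3 + (p - 1) equals \<open>i + j + l\<close>, so the extracted coefficient is
  of top degree and explicit. The Vandermonde product is antisymmetric in a and b, which puts a
  factor i - j into it; hence \<open>i \<noteq> j\<close>.\<close>

lemma no_solution_imp_dvd:
  fixes A :: "int set" and p k i j l :: nat and s :: int
  assumes p: "prime p" and k: "0 < k" "k + 2 < p"
    and A: "finite A" "card A = k + 2"
    and distinct: "\<And>a b. a \<in> A \<Longrightarrow> b \<in> A \<Longrightarrow> a \<noteq> b \<Longrightarrow> \<not> int p dvd a - b"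
    and none: "\<And>a b c. a \<in> A \<Longrightarrow> b \<in> A \<Longrightarrow> c \<in> A \<Longrightarrow> a \<noteq> b \<Longrightarrow> a \<noteq> c \<Longrightarrow> b \<noteq> c \<Longrightarrow>
      \<not> [a + b + int k * c = s] (mod int p)"
    and ijl: "i \<le> k + 1" "j \<le> k + 1" "l \<le> k + 1" "i + j + l = p + 2" "2 \<le> l" "i \<noteq> j"
  shows "int p dvd int k ^ 2 * (int i * int j) + (int k + 1) * (int l * (int l - 1))"
proof -
  have q: "prime (int p)" using p by simp
  have weights: "\<exists>B w. B \<subseteq> A \<and>
      (\<forall>m\<le>n. [(\<Sum>a\<in>B. w a * a ^ m) = (if m = n then 1 else 0)] (mod int p))"
    if n: "n \<le> k + 1" for n
  proof -
    have "Suc n \<le> card A" using n A by simp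
    then obtain B where B: "B \<subseteq> A" "card B = Suc n" "finite B"
      by (meson obtain_subset_with_card_n)
    then show ?thesis using dual_weights_exist[OF q B(3,2)] distinct by (meson subsetD)
  qed
  obtain A1 u where A1: "A1 \<subseteq> A"
      "\<And>m. m \<le> i \<Longrightarrow> [(\<Sum>a\<in>A1. u a * a ^ m) = (if m = i then 1 else 0)] (mod int p)"
    using weights[OF ijl(1)] by metis
  obtain A2 v where A2: "A2 \<subseteq> A"
      "\<And>m. m \<le> j \<Longrightarrow> [(\<Sum>a\<in>A2. v a * a ^ m) = (if m = j then 1 else 0)] (mod int p)"
    using weights[OF ijl(2)] by metis
  obtain A3 w where A3: "A3 \<subseteq> A"
      "\<And>m. m \<le> l \<Longrightarrow> [(\<Sum>a\<in>A3. w a * a ^ m) = (if m = l then 1 else 0)] (mod int p)"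
    using weights[OF ijl(3)] by metis
  interpret weighted_box "int p" A1 A2 A3 u v w i j l "int k" s
    by unfold_locales (fact A1 A2 A3)+
  \<comment> \<open>The six signed monomials of (a - b)(a - c)(b - c).\<close>
  define V where "V m = moment 2 1 0 m - moment 2 0 1 m - moment 1 2 0 m + moment 1 0 2 m
      + moment 0 2 1 m - moment 0 1 2 m" for m
  have V: "V m = (\<Sum>a\<in>A1. \<Sum>b\<in>A2. \<Sum>c\<in>A3.
      u a * v b * w c * ((a - b) * (a - c) * (b - c) * (a + b + int k * c - s) ^ m))" for m
    unfolding V_def moment_def sum_distrib_left sum.distrib[symmetric] sum_subtractf[symmetric]
    by (intro sum.cong refl) (simp add: algebra_simps power2_eq_square)
  have fermat: "[(a - b) * (a - c) * (b - c) * (a + b + int k * c - s) ^ (p - 1) =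
      (a - b) * (a - c) * (b - c) * (a + b + int k * c - s) ^ 0] (mod int p)"
    if "a \<in> A" "b \<in> A" "c \<in> A" for a b c
  \<comment> \<open>Coinciding entries make both sides 0; otherwise \<open>none\<close> makes the
    base of the power a unit.\<close>
  proof (cases "a = b \<or> a = c \<or> b = c")
    case False
    then have "\<not> int p dvd a + b + int k * c - s"
      using none[OF that] by (simp add: cong_iff_dvd_diff)
    from fermat_int[OF p this] show ?thesis by (intro cong_mult cong_refl) simp
  qed auto
  have "[V (p - 1) = V 0] (mod int p)"
    unfolding V using A1(1) A2(1) A3(1)
    by (intro cong_sum) (intro cong_mult[OF cong_refl fermat], auto)
  \<comment> \<open>Degree 3 lies below \<open>p + 2\<close>.\<close>
  moreover have "[V 0 = 0 - 0 - 0 + 0 + 0 - 0] (mod int p)"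
    unfolding V_def using ijl(4) k by (intro cong_add cong_diff moment_low_degree) auto
  ultimately have V_0: "[V (p - 1) * (fact i * fact j * fact l) = 0] (mod int p)"
    by (simp add: cong_0_iff cong_dvd_iff)
  \<comment> \<open>The common factor of the six terms, where the exponent of c is at most 2 and
    \<open>2 \<le> l\<close>; it is a unit modulo \<open>p\<close>.\<close>
  define P where "P = fact (p - 1) * int k ^ (l - 2)"
  let ?I = "int i" and ?J = "int j" and ?L = "int l" and ?K = "int k"
  have top: "[moment x y z (p - 1) * (fact i * fact j * fact l) =
      P * (?K ^ (2 - z) * (falling i x * falling j y * falling l z))] (mod int p)"
    if "x + y + z = 3" "z \<le> 2" for x y z
  proof -
    have "l - z = (l - 2) + (2 - z)" using that ijl(5) by simp
    then have "?K ^ (l - z) = ?K ^ (l - 2) * ?K ^ (2 - z)" by (metis power_add)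
    moreover have "x + y + z + (p - 1) = i + j + l" using that ijl(4) k by simp
    ultimately show ?thesis using moment_top_degree[of x y z "p - 1"] by (simp add: P_def mult_ac)
  qed
  have falls: "falling n 0 = 1" "falling n 1 = int n" "falling n 2 = int n * (int n - 1)" for n
    by (simp_all add: falling_def numeral_2_eq_2)
  have "[V (p - 1) * (fact i * fact j * fact l) =
      P * (?K ^ (2 - 0) * (falling i 2 * falling j 1 * falling l 0))
      - P * (?K ^ (2 - 1) * (falling i 2 * falling j 0 * falling l 1))
      - P * (?K ^ (2 - 0) * (falling i 1 * falling j 2 * falling l 0))
      + P * (?K ^ (2 - 2) * (falling i 1 * falling j 0 * falling l 2))
      + P * (?K ^ (2 - 1) * (falling i 0 * falling j 2 * falling l 1))
      - P * (?K ^ (2 - 2) * (falling i 0 * falling j 1 * falling l 2))] (mod int p)"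
    unfolding V_def left_diff_distrib distrib_right by (intro cong_add cong_diff top) auto
  from cong_trans[OF cong_sym[OF this] V_0]
  have "int p dvd
      P * (?K ^ (2 - 0) * (falling i 2 * falling j 1 * falling l 0))
      - P * (?K ^ (2 - 1) * (falling i 2 * falling j 0 * falling l 1))
      - P * (?K ^ (2 - 0) * (falling i 1 * falling j 2 * falling l 0))
      + P * (?K ^ (2 - 2) * (falling i 1 * falling j 0 * falling l 2))
      + P * (?K ^ (2 - 1) * (falling i 0 * falling j 2 * falling l 1))
      - P * (?K ^ (2 - 2) * (falling i 0 * falling j 1 * falling l 2))"
    unfolding cong_0_iff .
  also have "\<dots> = P * ((?I - ?J) * (?K ^ 2 * (?I * ?J) - ?K * ?L * (?I + ?J - 1) + ?L * (?L - 1)))"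
    unfolding falls by (simp add: algebra_simps power2_eq_square)
  finally have "int p dvd P * ((?I - ?J) * (?K ^ 2 * (?I * ?J) - ?K * ?L * (?I + ?J - 1) + ?L * (?L - 1)))" .
  moreover have "\<not> int p dvd P"
  proof -
    have "\<not> p dvd fact (p - 1)" using p k by (simp add: prime_dvd_fact_iff)
    then have "\<not> int p dvd fact (p - 1)" by (metis int_dvd_int_iff of_nat_fact)
    moreover have "\<not> int p dvd ?K" using k by (auto dest: dvd_imp_le)
    ultimately show ?thesis
      unfolding P_def using q prime_dvd_mult_iff prime_dvd_power by blast
  qed
  \<comment> \<open>Both exponents are at most \<open>k + 1 < p\<close>, so their nonzero difference
    is smaller than \<open>p\<close> in absolute value.\<close>
  moreover have "\<not> int p dvd ?I - ?J"
    using ijl k zdvd_imp_le[of "int p" "?I - ?J"] zdvd_imp_le[of "int p" "?J - ?I"]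
    by (cases "i < j") (auto simp: dvd_diff_commute)
  ultimately have "int p dvd ?K ^ 2 * (?I * ?J) - ?K * ?L * (?I + ?J - 1) + ?L * (?L - 1)"
    using q prime_dvd_mult_iff by blast
  \<comment> \<open>Modulo \<open>p\<close> the middle term becomes
    \<open>?K * ?L * (?L - 1)\<close> and merges with the last one.\<close>
  moreover have "?I + ?J - 1 = int p - (?L - 1)" using ijl(4) by linarith
  ultimately have "int p dvd ?K ^ 2 * (?I * ?J) + (?K + 1) * (?L * (?L - 1)) - int p * (?K * ?L)"
    by (simp add: algebra_simps)
  from dvd_add[OF this dvd_triv_left, of "?K * ?L"] show ?thesis by simp
qed

section \<open>Solving a + b + k c = s in distinct elements\<close>

text \<open>Two exponent pairs with the same \<open>l\<close> give two multiples of
  \<open>p\<close>. Their difference is k^2 ((i + 1) k - i (k + 1)) = k^2 (k - i), whose factors k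
  and k - i lie strictly between 0 and \<open>p\<close>.\<close>

lemma sum_of_three_distinct:
  fixes A :: "int set" and p k :: nat and s :: int
  assumes p: "prime p" and k: "3 \<le> k" "k + 3 \<le> p" "p + 2 \<le> 3 * k"
    and A: "finite A" "card A = k + 2"
    and distinct: "\<And>a b. a \<in> A \<Longrightarrow> b \<in> A \<Longrightarrow> a \<noteq> b \<Longrightarrow> \<not> int p dvd a - b"
  shows "\<exists>a\<in>A. \<exists>b\<in>A. \<exists>c\<in>A. a \<noteq> b \<and> a \<noteq> c \<and> b \<noteq> c \<and>
    [a + b + int k * c = s] (mod int p)"
proof (rule ccontr)
  assume "\<not> ?thesis"
  then have none: "\<not> [a + b + int k * c = s] (mod int p)"
    if "a \<in> A" "b \<in> A" "c \<in> A" "a \<noteq> b" "a \<noteq> c" "b \<noteq> c" for a b c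
    using that by blast
  \<comment> \<open>The hypothesis 3 k \<ge> p + 2 is exactly what makes both exponent pairs (i, k + 1) and
    (i + 1, k) possible with a common third exponent l \<le> k + 1.\<close>
  define i where "i = min (k - 2) (p - 1 - k)"
  define l where "l = p + 1 - k - i"
  have il: "i + l = p + 1 - k" "2 \<le> l" "l \<le> k + 1" "i + 2 \<le> k"
    using k unfolding i_def l_def by linarith+
  have "int p dvd int k ^ 2 * (int i * int (k + 1)) + (int k + 1) * (int l * (int l - 1))"
    using il k by (intro no_solution_imp_dvd[OF p _ _ A distinct none]) auto
  moreover have "int p dvd int k ^ 2 * (int (i + 1) * int k) + (int k + 1) * (int l * (int l - 1))"
    using il k by (intro no_solution_imp_dvd[OF p _ _ A distinct none]) auto
  ultimately have "int p dvd
      (int k ^ 2 * (int (i + 1) * int k) + (int k + 1) * (int l * (int l - 1))) -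
      (int k ^ 2 * (int i * int (k + 1)) + (int k + 1) * (int l * (int l - 1)))"
    by (rule dvd_diff[rotated])
  also have "\<dots> = int k ^ 2 * int (k - i)"
    using il by (simp add: algebra_simps of_nat_diff)
  finally have "p dvd k ^ 2 * (k - i)"
    by (metis int_dvd_int_iff of_nat_mult of_nat_power)
  then have "p dvd k \<or> p dvd k - i"
    using p by (metis prime_dvd_mult_iff prime_dvd_power)
  then show False using k il by (auto dest: dvd_imp_le)
qed

section \<open>Translation to the group and the upper bound\<close>

lemma finprod_integer_mod_group:
  assumes "finite B" "B \<subseteq> carrier (integer_mod_group n)"
  shows "finprod (integer_mod_group n) (\<lambda>x. x) B = \<Sum>B mod int n"
  using assms
proof (induction B rule: finite_induct)
  case empty
  interpret comm_group "integer_mod_group n" by simp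
  show ?case by simp
next
  case (insert x B)
  interpret comm_group "integer_mod_group n" by simp
  have "finprod (integer_mod_group n) (\<lambda>x. x) (insert x B) = (x + \<Sum>B mod int n) mod int n"
    using insert by (subst finprod_insert) auto
  then show ?case using insert by (simp add: mod_add_right_eq)
qed

lemma barycentric_integer_mod_group_iff:
  assumes "finite B" "B \<subseteq> carrier (integer_mod_group n)"
  shows "barycentric (integer_mod_group n) k B \<longleftrightarrow>
    card B = k \<and> (\<exists>g\<in>B. [\<Sum>B = int k * g] (mod int n))"
  using assms by (simp add: barycentric_def finprod_integer_mod_group cong_def)

lemma contains_barycentric:
  assumes p: "prime p" and k: "3 \<le> k" "k + 3 \<le> p" "p + 2 \<le> 3 * k"
    and A: "A \<subseteq> carrier (integer_mod_group p)" "k + 2 \<le> card A"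
  shows "\<exists>B\<subseteq>A. barycentric (integer_mod_group p) k B"
proof -
  obtain D where D: "D \<subseteq> A" "card D = k + 2" "finite D"
    using A(2) by (meson obtain_subset_with_card_n)
  have D_range: "D \<subseteq> {0..<int p}" using D A k by (auto simp: carrier_integer_mod_group)
  have "\<not> int p dvd a - b" if "a \<in> D" "b \<in> D" "a \<noteq> b" for a b
  proof -
    have "a mod int p = a" "b mod int p = b" using D_range that by auto
    with that(3) show ?thesis by (metis mod_eq_dvd_iff)
  qed
  then obtain a b c where abc: "a \<in> D" "b \<in> D" "c \<in> D" "a \<noteq> b" "a \<noteq> c" "b \<noteq> c"
    "[a + b + int k * c = \<Sum>D] (mod int p)"
    using sum_of_three_distinct[OF p k D(3,2)] by blast
  \<comment> \<open>As \<open>c\<close> differs from \<open>a\<close> and \<open>b\<close> it stays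
    in \<open>B\<close>, so it can serve as the average.\<close>
  define B where "B = D - {a, b}"
  have "card B = k" using abc D by (simp add: B_def card_Diff_subset)
  moreover have "\<Sum>D = a + b + \<Sum>B"
    using abc D sum.subset_diff[of "{a, b}" D "\<lambda>x. x"] by (simp add: B_def)
  then have "[\<Sum>B = int k * c] (mod int p)"
    using abc(7) by (simp add: cong_add_lcancel cong_sym_eq)
  moreover have "c \<in> B" using abc by (simp add: B_def)
  moreover have "finite B" "B \<subseteq> A" using D by (auto simp: B_def)
  ultimately show ?thesis using A(1) barycentric_integer_mod_group_iff[of B p k] by blast
qed

section \<open>Zero-sum sets and the lower bound\<close>

text \<open>For even \<open>k\<close> a set symmetric about 0 works. For odd \<open>k\<close> a
  symmetric set with \<open>k + 3\<close> elements loses three elements of sum 0.\<close>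

lemma zero_sum_set_exists:
  assumes "3 \<le> k" "k + 2 \<le> 2 * n"
  obtains S :: "int set" where "finite S" "card S = k" "0 \<notin> S" "\<Sum>S = 0" "S \<subseteq> {- int n..int n}"
proof -
  define sym where "sym m = {1..int m} \<union> {- int m..-1}" for m
  have fin: "finite (sym m)" for m by (simp add: sym_def)
  have card: "card (sym m) = 2 * m" for m
    unfolding sym_def by (subst card_Un_disjoint) auto
  have sum: "\<Sum>(sym m) = 0" for m
  proof -
    have "\<Sum>(sym m) = \<Sum>(uminus ` sym m)"
      by (rule arg_cong[where f = "\<lambda>S. \<Sum>S"]) (auto simp: sym_def image_Un)
    also have "\<dots> = - \<Sum>(sym m)"
      by (simp add: sum.reindex sum_negf)
    finally show ?thesis by simp
  qed
  show thesis
  proof (cases "even k")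
    case True
    then obtain m where "k = 2 * m" by blast
    with assms show ?thesis using fin card sum by (intro that[of "sym m"]) (auto simp: sym_def)
  next
    case False
    then obtain m where m: "k = 2 * m + 1" by (rule oddE)
    \<comment> \<open>Since \<open>k \<ge> 3\<close> gives \<open>m \<ge> 1\<close>, the element 3
      is present; parity sharpens \<open>k + 2 \<le> 2 * n\<close> to
      \<open>m + 2 \<le> n\<close>.\<close>
    define T where "T = sym (m + 2) - {-1, -2, 3}"
    have sub: "{-1, -2, 3} \<subseteq> sym (m + 2)" using m assms by (auto simp: sym_def)
    have "card T = k"
      using sub m by (simp add: T_def card_Diff_subset card)
    moreover have "\<Sum>T = 0"
      using sum.subset_diff[OF sub fin, of "\<lambda>x. x"] sum[of "m + 2"] by (simp add: T_def)
    moreover have "finite T" "0 \<notin> T" using fin by (auto simp: T_def sym_def)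
    moreover have "T \<subseteq> {- int n..int n}" using m assms False by (auto simp: T_def sym_def)
    ultimately show ?thesis using that by blast
  qed
qed

theorem mainTheorem8:
  fixes p k :: nat
  assumes "prime p" and "p \<ge> 7"
    and "3 * k \<ge> p + 2" and "k \<le> p - 3"
  shows "k + 1 \<le> BO k (integer_mod_group p) \<and> BO k (integer_mod_group p) \<le> k + 2"
proof -
  let ?G = "integer_mod_group p"
  let ?P = "\<lambda>n. \<forall>A. A \<subseteq> carrier ?G \<and> n \<le> card A \<longrightarrow> (\<exists>B\<subseteq>A. barycentric ?G k B)"
  have k: "3 \<le> k" "k + 3 \<le> p" "p + 2 \<le> 3 * k" using assms by auto
  have P: "?P (k + 2)" using contains_barycentric[OF assms(1) k] by blast
  have upper: "BO k ?G \<le> k + 2" unfolding BO_def by (rule Least_le) (rule P)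
  \<comment> \<open>The bound \<open>k + 2\<close> witnesses that the \<open>LEAST\<close> is
    attained, so \<open>BO\<close> itself has the property.\<close>
  have BO: "?P (BO k ?G)" unfolding BO_def by (rule LeastI) (rule P)
  have "odd p" using assms(1,2) prime_odd_nat by auto
  then obtain n where n: "p = 2 * n + 1" by (rule oddE)
  \<comment> \<open>The interval from -n to n represents each residue modulo
    \<open>p = 2 * n + 1\<close> once, so reduction is injective on \<open>S\<close> and keeps 0
    out.\<close>
  obtain S where S: "finite S" "card S = k" "0 \<notin> S" "\<Sum>S = 0" "S \<subseteq> {- int n..int n}"
    by (rule zero_sum_set_exists[of k n]) (use k n in auto)
  let ?T = "(\<lambda>x. x mod int p) ` S"
  have no_dvd: "\<not> int p dvd x" if "x \<noteq> 0" "\<bar>x\<bar> < int p" for x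
    using that dvd_imp_le_int[of x "int p"] by linarith
  have inj: "inj_on (\<lambda>x. x mod int p) S"
  proof (rule inj_onI)
    fix x y assume xy: "x \<in> S" "y \<in> S" "x mod int p = y mod int p"
    then have "int p dvd x - y" by (simp add: mod_eq_dvd_iff)
    moreover have "\<bar>x - y\<bar> < int p" using subsetD[OF S(5) xy(1)] subsetD[OF S(5) xy(2)] n by auto
    ultimately show "x = y" using no_dvd[of "x - y"] by auto
  qed
  have T: "finite ?T" "card ?T = k" "?T \<subseteq> carrier ?G"
    using S(1,2) inj n by (auto simp: card_image carrier_integer_mod_group)
  \<comment> \<open>The sum is 0 modulo \<open>p\<close>, whereas \<open>p\<close> divides neither
    \<open>k\<close> nor any element of \<open>S\<close>.\<close>
  have "\<not> barycentric ?G k ?T"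
  proof
    assume "barycentric ?G k ?T"
    then obtain g where g: "g \<in> S" and eq: "[\<Sum>?T = int k * (g mod int p)] (mod int p)"
      using barycentric_integer_mod_group_iff[OF T(1,3)] by auto
    have "\<Sum>?T = (\<Sum>x\<in>S. x mod int p)" using inj by (simp add: sum.reindex)
    moreover have "[(\<Sum>x\<in>S. x mod int p) = \<Sum>S] (mod int p)"
      by (intro cong_sum) simp
    ultimately have "[int k * (g mod int p) = 0] (mod int p)"
      using eq S(4) unfolding cong_def by simp
    then have "int p dvd int k * (g mod int p)" by (simp add: cong_0_iff)
    then have "int p dvd int k \<or> int p dvd g mod int p"
      using assms(1) prime_dvd_mult_iff[of "int p"] by simp
    then have "int p dvd int k \<or> int p dvd g" by (simp add: dvd_mod_iff)
    moreover have "\<bar>g\<bar> < int p" using S(5) g n by force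
    moreover have "g \<noteq> 0" using S(3) g by blast
    ultimately show False using no_dvd[of g] no_dvd[of "int k"] k by auto
  qed
  \<comment> \<open>The only \<open>k\<close>-element subset of \<open>?T\<close> is
    \<open>?T\<close> itself.\<close>
  have "\<not> BO k ?G \<le> k"
  proof
    assume "BO k ?G \<le> k"
    then obtain B where B: "B \<subseteq> ?T" "barycentric ?G k B" using BO T by metis
    then have "B = ?T" using T card_subset_eq by (metis barycentric_def)
    with B(2) \<open>\<not> barycentric ?G k ?T\<close> show False by simp
  qed
  with upper show ?thesis by simp
qed

end
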